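(* Let $\mathbb{F}=\mathbb{R}$ or $\mathbb{C}$, let $P=\{W_i\}_{i=1}^k$ be an orthonormal fusion basis for $\mathbb{F}^n$, and let $Q$ be the canonical dual for $P$. Then $\phi(P,Q)=n$.
   Context: A fusion frame for $\mathbb{F}^n$ is a finite sequence of subspaces $\{W_i\}_{i=1}^k$ for which there are constants $0<A\le B<\infty$ with $A\|f\|^2\le\sum_{i=1}^k\|P_if\|^2\le B\|f\|^2$ for all $f\in\mathbb{F}^n$, where $P_i$ is the orthogonal projection onto $W_i$; the fusion frame is identified with the sequence $\{P_i\}_{i=1}^k$. An orthonormal fusion basis for $\mathbb{F}^n$ is a fusion frame $\{W_i\}_{i=1}^k$ such that $\mathbb{F}^n$ is the orthogonal (direct) sum of the subspaces $W_i$. The fusion frame operator is $S=\sum_{i=1}^kP_i$, and the canonical dual is the sequence of subspaces $\{S^{-1}W_i\}_{i=1}^k$ (identified with the sequence of orthogonal projections onto these subspaces). The cross fusion frame potential of fusion frames $P=\{P_i\}_{i=1}^k$ and $Q=\{Q_i\}_{i=1}^k$ (given by orthogonal projections) is $\phi(P,Q)=\sum_{i=1}^k\sum_{j=1}^k\mathrm{Tr}(P_iQ_j)$. *)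

theory Defs
  imports "HOL-Analysis.Analysis" "Jordan_Normal_Form.Conjugate"
begin

text \<open>
  Vectors of $F^n$ are elements of the type \<open>'a ^ 'n\<close> with \<open>'a\<close> the type of real or of complex
  numbers. The class \<open>conjugatable_field\<close> supplies \<open>conjugate\<close>, which is the identity on the reals
  and complex conjugation on the complex numbers, so that both cases share their definitions.
  Subspaces are \<open>'a\<close>-linear (\<open>vec.subspace\<close>).
\<close>

text \<open>
  The library inner product \<open>\<bullet>\<close> on \<open>complex ^ 'n\<close> is real-valued (the real part of the Hermitian
  one), hence the definition below. The library norm is the norm that it induces.
\<close>

definition hinner :: "('a::conjugatable_field) ^ 'n \<Rightarrow> 'a ^ 'n \<Rightarrow> 'a" where
  "hinner x y = (\<Sum>i\<in>UNIV. x $ i * conjugate (y $ i))"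

definition orth_proj :: "(('a::conjugatable_field) ^ 'n) set \<Rightarrow> 'a ^ 'n \<Rightarrow> 'a ^ 'n" where
  "orth_proj W f = (THE g. g \<in> W \<and> (\<forall>w\<in>W. hinner (f - g) w = 0))"

definition op_trace :: "(('a::field) ^ 'n \<Rightarrow> 'a ^ 'n) \<Rightarrow> 'a" where
  "op_trace T = trace (matrix T)"

text \<open>
  A sequence of \<open>k\<close> subspaces is a function on \<open>nat\<close> of which only the values at \<open>1, \<dots>, k\<close> matter;
  repetitions and zero subspaces are allowed.
\<close>

definition fusion_frame ::
  "nat \<Rightarrow> (nat \<Rightarrow> (('a::{real_normed_field, conjugatable_field}) ^ 'n) set) \<Rightarrow> bool" where
  "fusion_frame k W \<longleftrightarrow>
     (\<forall>i\<in>{1..k}. vec.subspace (W i)) \<and>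
     (\<exists>A B :: real. 0 < A \<and> A \<le> B \<and>
        (\<forall>f. A * (norm f)\<^sup>2 \<le> (\<Sum>i=1..k. (norm (orth_proj (W i) f))\<^sup>2) \<and>
             (\<Sum>i=1..k. (norm (orth_proj (W i) f))\<^sup>2) \<le> B * (norm f)\<^sup>2))"

definition orthogonal_direct_sum ::
  "nat \<Rightarrow> (nat \<Rightarrow> (('a::conjugatable_field) ^ 'n) set) \<Rightarrow> bool" where
  "orthogonal_direct_sum k W \<longleftrightarrow>
     (\<forall>i\<in>{1..k}. \<forall>j\<in>{1..k}. i \<noteq> j \<longrightarrow> (\<forall>u\<in>W i. \<forall>v\<in>W j. hinner u v = 0)) \<and>
     (\<forall>f. \<exists>!w. w \<in> (\<Pi>\<^sub>E i\<in>{1..k}. W i) \<and> f = (\<Sum>i=1..k. w i))"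

definition orthonormal_fusion_basis ::
  "nat \<Rightarrow> (nat \<Rightarrow> (('a::{real_normed_field, conjugatable_field}) ^ 'n) set) \<Rightarrow> bool" where
  "orthonormal_fusion_basis k W \<longleftrightarrow> fusion_frame k W \<and> orthogonal_direct_sum k W"

definition fusion_frame_operator ::
  "nat \<Rightarrow> (nat \<Rightarrow> (('a::conjugatable_field) ^ 'n) set) \<Rightarrow> 'a ^ 'n \<Rightarrow> 'a ^ 'n" where
  "fusion_frame_operator k W f = (\<Sum>i=1..k. orth_proj (W i) f)"

text \<open>The inverse below is meaningful because the operator of a fusion frame is bijective.\<close>

definition canonical_dual ::
  "nat \<Rightarrow> (nat \<Rightarrow> (('a::conjugatable_field) ^ 'n) set) \<Rightarrow> nat \<Rightarrow> ('a ^ 'n) set" where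
  "canonical_dual k W i = inv (fusion_frame_operator k W) ` W i"

definition cross_potential ::
  "nat \<Rightarrow> (nat \<Rightarrow> (('a::conjugatable_field) ^ 'n) set) \<Rightarrow> (nat \<Rightarrow> ('a ^ 'n) set) \<Rightarrow> 'a" where
  "cross_potential k V W =
     (\<Sum>i=1..k. \<Sum>j=1..k. op_trace (orth_proj (V i) \<circ> orth_proj (W j)))"

end

theory Submission
  imports Defs
begin

text \<open>
  For an orthonormal fusion basis the projection onto \<open>W\<^sub>i\<close> picks out the \<open>i\<close>-th component of the
  direct sum decomposition, so the frame operator is the identity and the basis is its own canonical
  dual. Hence \<open>\<phi>(P, P) = Tr (S \<circ> S) = Tr id = n\<close>.
\<close>

lemma hinner_diff_left: "hinner (x - y) z = hinner x z - hinner y z"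
  by (simp add: hinner_def left_diff_distrib sum_subtractf)

lemma hinner_sum_left: "hinner (\<Sum>i\<in>A. f i) z = (\<Sum>i\<in>A. hinner (f i) z)"
  unfolding hinner_def sum_component sum_distrib_right by (rule sum.swap)

lemma hinner_real_self_eq_0:
  fixes x :: "real ^ 'n"
  assumes "hinner x x = 0"
  shows "x = 0"
  using assms by (simp add: hinner_def vec_eq_iff sum_nonneg_eq_0_iff)

lemma hinner_complex_self_eq_0:
  fixes x :: "complex ^ 'n"
  assumes "hinner x x = 0"
  shows "x = 0"
proof -
  \<comment> \<open>Each z * cnj z is the squared modulus of z, so the equation descends to a real
    sum of nonnegative terms.\<close>
  have "complex_of_real (\<Sum>i\<in>UNIV. (cmod (x $ i))\<^sup>2) = 0"
    using assms by (simp add: hinner_def complex_mult_cnj cmod_power2)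
  then have "(\<Sum>i\<in>UNIV. (cmod (x $ i))\<^sup>2) = 0"
    using of_real_eq_0_iff by blast
  then show ?thesis
    by (simp add: vec_eq_iff sum_nonneg_eq_0_iff)
qed

text \<open>If g and h both qualify, then h - g = (f - g) - (f - h) lies in W and is orthogonal to
  W, hence to itself. A general \<open>conjugatable_field\<close> may have isotropic vectors, so
  \<open>definite\<close> is assumed here and discharged for each of the two fields at the
  end.\<close>

lemma orth_proj_eqI:
  fixes W :: "('a::conjugatable_field ^ 'n) set"
  assumes definite: "\<And>x :: 'a ^ 'n. hinner x x = 0 \<Longrightarrow> x = 0"
    and "vec.subspace W" "g \<in> W" "\<And>w. w \<in> W \<Longrightarrow> hinner (f - g) w = 0"
  shows "orth_proj W f = g"
  unfolding orth_proj_def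
proof (rule the_equality)
  fix h assume h: "h \<in> W \<and> (\<forall>w\<in>W. hinner (f - h) w = 0)"
  then have "h - g \<in> W"
    using assms(2,3) vec.subspace_diff by blast
  then have "hinner (f - g) (h - g) - hinner (f - h) (h - g) = 0"
    using h assms(4) by simp
  then have "hinner (h - g) (h - g) = 0"
    by (simp flip: hinner_diff_left)
  then show "h = g"
    using definite[of "h - g"] by simp
qed (simp add: assms)

lemma fusion_frame_operator_orthogonal_direct_sum:
  fixes W :: "nat \<Rightarrow> ('a::conjugatable_field ^ 'n) set"
  assumes definite: "\<And>x :: 'a ^ 'n. hinner x x = 0 \<Longrightarrow> x = 0"
    and sub: "\<And>i. i \<in> {1..k} \<Longrightarrow> vec.subspace (W i)"
    and ods: "orthogonal_direct_sum k W"
  shows "fusion_frame_operator k W f = f"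
proof -
  obtain w where "w \<in> (\<Pi>\<^sub>E i\<in>{1..k}. W i)" and f: "f = (\<Sum>i=1..k. w i)"
    using ods unfolding orthogonal_direct_sum_def by blast
  then have w: "w i \<in> W i" if "i \<in> {1..k}" for i
    using that by (simp add: PiE_mem)
  have orth: "hinner u v = 0"
    if "i \<in> {1..k}" "j \<in> {1..k}" "i \<noteq> j" "u \<in> W i" "v \<in> W j" for i j u v
    using ods that unfolding orthogonal_direct_sum_def by blast
  have "orth_proj (W i) f = w i" if i: "i \<in> {1..k}" for i
  proof (rule orth_proj_eqI[OF definite sub[OF i] w[OF i]])
    fix v assume v: "v \<in> W i"
    \<comment> \<open>The residual consists of the components in the other subspaces, all orthogonal
      to \<open>W i\<close>.\<close>
    have "f - w i = (\<Sum>j\<in>{1..k} - {i}. w j)"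
      using i by (simp add: f sum_diff1)
    then have "hinner (f - w i) v = (\<Sum>j\<in>{1..k} - {i}. hinner (w j) v)"
      by (simp only: hinner_sum_left)
    also have "\<dots> = 0"
      using i v w orth by (intro sum.neutral) blast
    finally show "hinner (f - w i) v = 0" .
  qed
  then show ?thesis
    by (simp add: fusion_frame_operator_def f)
qed

text \<open>\<open>matrix\<close> reads off values at the standard basis vectors only, so diagonal
  entries add up for arbitrary maps \<open>T i\<close>.\<close>

lemma op_trace_sum: "op_trace (\<lambda>f. \<Sum>i\<in>A. T i f) = (\<Sum>i\<in>A. op_trace (T i))"
  unfolding op_trace_def trace_def matrix_def by (simp, rule sum.swap)

lemma op_trace_ident: "op_trace (\<lambda>f :: 'a::field ^ 'n. f) = of_nat CARD('n)"
  by (simp add: op_trace_def trace_def matrix_def)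

lemma cross_potential_canonical_dual:
  fixes W :: "nat \<Rightarrow> ('a::{real_normed_field, conjugatable_field} ^ 'n) set"
  assumes definite: "\<And>x :: 'a ^ 'n. hinner x x = 0 \<Longrightarrow> x = 0"
    and "orthonormal_fusion_basis k W"
  shows "cross_potential k W (canonical_dual k W) = of_nat CARD('n)"
proof -
  have S: "fusion_frame_operator k W f = f" for f
    using assms(2) unfolding orthonormal_fusion_basis_def fusion_frame_def
    by (intro fusion_frame_operator_orthogonal_direct_sum[OF definite]) simp_all
  then have "fusion_frame_operator k W = id"
    by auto
  then have dual: "canonical_dual k W = W"
    by (auto simp: canonical_dual_def)
  \<comment> \<open>The swap puts the sum over the outer projections innermost: it is S at the
    vector \<open>orth_proj (W j) f\<close>. Applying S = id pointwise, first there and then to the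
    sum over j, collapses both sums without appeal to linearity of the projections.\<close>
  have "cross_potential k W W =
      op_trace (\<lambda>f. \<Sum>j=1..k. \<Sum>i=1..k. orth_proj (W i) (orth_proj (W j) f))"
    unfolding cross_potential_def op_trace_sum comp_def by (rule sum.swap)
  also have "\<dots> = op_trace (\<lambda>f :: 'a ^ 'n. f)"
    using S by (simp add: fusion_frame_operator_def)
  finally show ?thesis
    by (simp add: dual op_trace_ident)
qed

theorem corollary47:
  shows "(\<forall>k (W :: nat \<Rightarrow> (real ^ 'n) set).
            orthonormal_fusion_basis k W \<longrightarrow>
            cross_potential k W (canonical_dual k W) = of_nat CARD('n)) \<and>
         (\<forall>k (W :: nat \<Rightarrow> (complex ^ 'n) set).
            orthonormal_fusion_basis k W \<longrightarrow>
            cross_potential k W (canonical_dual k W) = of_nat CARD('n))"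
  using cross_potential_canonical_dual[OF hinner_real_self_eq_0]
    cross_potential_canonical_dual[OF hinner_complex_self_eq_0] by blast

end
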